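(* Up to isomorphism of categories (not necessarily preserving an ordering of the objects) there is exactly one reduced category associated to the matrix $M_2^2$; that is, $\mathcal{C}ard(M_2^2,r)=1$.
   Context: $M_2^2$ is the $2\times 2$ matrix all of whose coefficients equal $2$. A category is associated to $M_2^2$ if it has exactly two objects $\lambda^1,\lambda^2$ and each of the four hom sets $\mathcal{A}(\lambda^i,\lambda^j)$, $i,j\in\{1,2\}$, has exactly $2$ elements. It is reduced if $\lambda^1$ and $\lambda^2$ are not isomorphic. An isomorphism of categories is a functor that is bijective on objects and on morphisms. $\mathcal{C}ard(M_2^2,r)$ is the number of isomorphism classes of reduced categories associated to $M_2^2$. *)

theory Defs
  imports "HOL-Analysis.Finite_Cartesian_Product"
begin

(* Comp C g f is the composite "g after f", meaningful when Cod C f = Dom C g.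
   Values of the fields outside the carriers Obj and Mor are irrelevant. *)
record ('o, 'm) cat =
  Obj :: "'o set"
  Mor :: "'m set"
  Dom :: "'m \<Rightarrow> 'o"
  Cod :: "'m \<Rightarrow> 'o"
  Id :: "'o \<Rightarrow> 'm"
  Comp :: "'m \<Rightarrow> 'm \<Rightarrow> 'm"

definition Hom :: "('o, 'm) cat \<Rightarrow> 'o \<Rightarrow> 'o \<Rightarrow> 'm set" where
  "Hom C a b = {f \<in> Mor C. Dom C f = a \<and> Cod C f = b}"

locale category =
  fixes C :: "('o, 'm) cat"
  assumes dom_obj: "f \<in> Mor C \<Longrightarrow> Dom C f \<in> Obj C"
    and cod_obj: "f \<in> Mor C \<Longrightarrow> Cod C f \<in> Obj C"
    and id_hom: "a \<in> Obj C \<Longrightarrow> Id C a \<in> Hom C a a"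
    and comp_hom: "\<lbrakk>f \<in> Hom C a b; g \<in> Hom C b c\<rbrakk> \<Longrightarrow> Comp C g f \<in> Hom C a c"
    and comp_id_right: "f \<in> Hom C a b \<Longrightarrow> Comp C f (Id C a) = f"
    and comp_id_left: "f \<in> Hom C a b \<Longrightarrow> Comp C (Id C b) f = f"
    and comp_assoc: "\<lbrakk>f \<in> Hom C a b; g \<in> Hom C b c; h \<in> Hom C c d\<rbrakk>
      \<Longrightarrow> Comp C h (Comp C g f) = Comp C (Comp C h g) f"

definition iso_objects :: "('o, 'm) cat \<Rightarrow> 'o \<Rightarrow> 'o \<Rightarrow> bool" where
  "iso_objects C a b \<longleftrightarrow>
     (\<exists>f \<in> Hom C a b. \<exists>g \<in> Hom C b a. Comp C g f = Id C a \<and> Comp C f g = Id C b)"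

definition is_functor ::
  "('o, 'm) cat \<Rightarrow> ('p, 'n) cat \<Rightarrow> ('o \<Rightarrow> 'p) \<Rightarrow> ('m \<Rightarrow> 'n) \<Rightarrow> bool" where
  "is_functor C D Fo Fm \<longleftrightarrow>
     (\<forall>a \<in> Obj C. Fo a \<in> Obj D) \<and>
     (\<forall>a \<in> Obj C. \<forall>b \<in> Obj C. \<forall>f \<in> Hom C a b. Fm f \<in> Hom D (Fo a) (Fo b)) \<and>
     (\<forall>a \<in> Obj C. Fm (Id C a) = Id D (Fo a)) \<and>
     (\<forall>f \<in> Mor C. \<forall>g \<in> Mor C. Cod C f = Dom C g \<longrightarrow> Fm (Comp C g f) = Comp D (Fm g) (Fm f))"

definition iso_categories :: "('o, 'm) cat \<Rightarrow> ('p, 'n) cat \<Rightarrow> bool" where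
  "iso_categories C D \<longleftrightarrow>
     (\<exists>Fo Fm. is_functor C D Fo Fm \<and> bij_betw Fo (Obj C) (Obj D) \<and> bij_betw Fm (Mor C) (Mor D))"

(* The enumeration l of the objects is existentially quantified: no ordering of
   the objects is part of the data of a category associated to a matrix. *)
definition associated :: "nat^'n^'n \<Rightarrow> ('o, 'm) cat \<Rightarrow> bool" where
  "associated M C \<longleftrightarrow> category C \<and>
     (\<exists>l :: 'n \<Rightarrow> 'o. bij_betw l UNIV (Obj C) \<and>
        (\<forall>i j. finite (Hom C (l i) (l j)) \<and> card (Hom C (l i) (l j)) = M $ i $ j))"

definition reduced :: "('o, 'm) cat \<Rightarrow> bool" where
  "reduced C \<longleftrightarrow> (\<forall>a \<in> Obj C. \<forall>b \<in> Obj C. a \<noteq> b \<longrightarrow> \<not> iso_objects C a b)"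

(* A category associated to a matrix has finitely many objects and morphisms, so
   it has an isomorphic copy with natural numbers as objects and morphisms. *)
definition reduced_cats :: "nat^'n^'n \<Rightarrow> (nat, nat) cat set" where
  "reduced_cats M = {C. associated M C \<and> reduced C}"

definition iso_rel :: "nat^'n^'n \<Rightarrow> ((nat, nat) cat \<times> (nat, nat) cat) set" where
  "iso_rel M = {(C, D). C \<in> reduced_cats M \<and> D \<in> reduced_cats M \<and> iso_categories C D}"

definition Card_r :: "nat^'n^'n \<Rightarrow> nat" where
  "Card_r M = card (reduced_cats M // iso_rel M)"

definition M22 :: "nat^2^2" where
  "M22 = (\<chi> i j. 2)"

end

theory Submission
  imports Defs
begin

text \<open>
  Let \<open>a \<noteq> b\<close> be the two objects. A two-element monoid has exactly one non-identity
  element; call it \<open>e\<^sub>a\<close> or \<open>e\<^sub>b\<close>. The key point is that no composite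
  \<open>a \<rightarrow> b \<rightarrow> a\<close> is an identity: if \<open>g f = 1\<close>, then composition with \<open>f\<close> maps
  \<open>Hom(b, a)\<close> injectively, hence by counting onto, \<open>Hom(b, b)\<close>; so \<open>f\<close> is also split
  epi and the objects are isomorphic (lemma \<open>retract_imp_iso\<close>). Therefore
  \<open>g f = e\<^sub>a\<close> for all \<open>f : a \<rightarrow> b\<close> and \<open>g : b \<rightarrow> a\<close>. Reassociating triple composites then
  shows that each \<open>e\<close> is idempotent and that \<open>e\<^sub>b f = f' e\<^sub>a\<close> for all \<open>f, f' : a \<rightarrow> b\<close>.
  Altogether, in each hom set there is one morphism \<open>z\<close> that is the value of every
  composite of two non-identity morphisms (lemma \<open>exists_zero_family\<close>).

  Such a family \<open>z\<close> determines the composition, because each hom set has only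
  one further element, which is the identity in the case of an endomorphism. So any
  bijection between the objects extends to an isomorphism (lemma
  \<open>zero_family_imp_iso\<close>). Conversely, declaring all composites of two non-identities
  to be such zeros is associative, which yields a model on the numbers below 8.
\<close>

section \<open>Zero families\<close>

definition nonid :: "('o, 'm) cat \<Rightarrow> 'm \<Rightarrow> bool" where
  "nonid C f \<longleftrightarrow> f \<in> Mor C \<and> f \<noteq> Id C (Dom C f)"

text \<open>An analogue of zero morphisms with products of non-identities only: since
  \<open>z\<close> has to be distinct from the identities, these never factor through non-identity
  morphisms.\<close>

definition zero_family :: "('o, 'm) cat \<Rightarrow> ('o \<Rightarrow> 'o \<Rightarrow> 'm) \<Rightarrow> bool" where
  "zero_family C z \<longleftrightarrow>
     (\<forall>a \<in> Obj C. \<forall>b \<in> Obj C. z a b \<in> Hom C a b \<and> nonid C (z a b)) \<and>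
     (\<forall>f g. nonid C f \<longrightarrow> nonid C g \<longrightarrow> Cod C f = Dom C g \<longrightarrow>
        Comp C g f = z (Dom C f) (Cod C g))"

lemma associated_M22_iff:
  "associated M22 C \<longleftrightarrow>
     category C \<and> card (Obj C) = 2 \<and> (\<forall>a \<in> Obj C. \<forall>b \<in> Obj C. card (Hom C a b) = 2)"
    (is "_ \<longleftrightarrow> ?R")
proof
  assume "associated M22 C"
  then obtain l :: "2 \<Rightarrow> 'a" where l: "category C" "bij_betw l UNIV (Obj C)"
      "\<And>i j. card (Hom C (l i) (l j)) = 2"
    by (auto simp: associated_def M22_def)
  have "card (Obj C) = 2"
    using bij_betw_same_card[OF l(2)] by simp
  moreover have "Obj C = range l"
    using l(2) by (simp add: bij_betw_def)
  ultimately show ?R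
    using l by auto
next
  assume R: ?R
  then have "finite (Obj C)"
    by (intro card_ge_0_finite) simp
  then obtain l :: "2 \<Rightarrow> 'a" where l: "bij_betw l UNIV (Obj C)"
    using finite_same_card_bij[of "UNIV :: 2 set" "Obj C"] R by auto
  have "l i \<in> Obj C" for i
    using l by (auto simp: bij_betw_def)
  then have "finite (Hom C (l i) (l j)) \<and> card (Hom C (l i) (l j)) = 2" for i j
    using R by (metis card.infinite zero_neq_numeral)
  then show "associated M22 C"
    using R l unfolding associated_def M22_def by auto
qed

lemma card_2_other:
  assumes "card A = 2" "x \<in> A" "y \<in> A" "y \<noteq> x" "w \<in> A" "w \<noteq> x"
  shows "y = w"
  using assms by (auto simp: card_2_iff)

section \<open>Uniqueness of the composition\<close>

text \<open>Counting replaces the second half of invertibility: a split mono \<open>a \<rightarrow> b\<close> embeds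
  \<open>Hom(b, a)\<close> into \<open>Hom(b, b)\<close>, and if there is no room left, the identity of \<open>b\<close> is
  hit.\<close>

lemma (in category) retract_imp_iso:
  assumes f: "f \<in> Hom C a b" and g: "g \<in> Hom C b a" and gf: "Comp C g f = Id C a"
    and fin: "finite (Hom C b b)" and le: "card (Hom C b b) \<le> card (Hom C b a)"
  shows "iso_objects C a b"
proof -
  have cancel: "Comp C g (Comp C f h) = h" if "h \<in> Hom C b a" for h
    using comp_assoc[OF that f g] gf comp_id_left[OF that] by simp
  have "inj_on (Comp C f) (Hom C b a)"
    by (metis cancel inj_onI)
  moreover have "Comp C f ` Hom C b a \<subseteq> Hom C b b"
    using comp_hom[OF _ f] by auto
  ultimately have "Comp C f ` Hom C b a = Hom C b b"
    using fin le by (metis card_image card_seteq)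
  moreover have "Id C b \<in> Hom C b b"
    using f id_hom cod_obj by (auto simp: Hom_def)
  ultimately obtain h where h: "h \<in> Hom C b a" "Comp C f h = Id C b"
    by (metis imageE)
  have "h = g"
    using cancel[OF h(1)] h(2) comp_id_right[OF g] by simp
  then show ?thesis
    using f g gf h by (auto simp: iso_objects_def)
qed

text \<open>After \<open>retract_imp_iso\<close> excludes round trips that are identities, counting leaves
  \<open>e a\<close> as their only value, and the triple composites settle all other products.\<close>

lemma (in category) exists_zero_family:
  assumes obj: "card (Obj C) = 2"
    and hom: "\<And>a b. a \<in> Obj C \<Longrightarrow> b \<in> Obj C \<Longrightarrow> card (Hom C a b) = 2"
    and red: "reduced C"
  shows "\<exists>z. zero_family C z"
proof -
  have nonid_ex: "\<exists>h. h \<in> Hom C a b \<and> h \<noteq> Id C a" if "a \<in> Obj C" "b \<in> Obj C" for a b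
    using hom[OF that] by (auto simp: card_2_iff)
  define e where "e a = (SOME h. h \<in> Hom C a a \<and> h \<noteq> Id C a)" for a
  have e: "e a \<in> Hom C a a" "e a \<noteq> Id C a" if "a \<in> Obj C" for a
    using someI_ex[OF nonid_ex[OF that that]] by (auto simp: e_def)
  have e_unique: "h = e a" if "h \<in> Hom C a a" "h \<noteq> Id C a" "a \<in> Obj C" for h a
    using card_2_other[OF hom[OF that(3) that(3)] id_hom[OF that(3)] that(1,2) e[OF that(3)]] .
  have round: "Comp C g f = e a"
    if "a \<noteq> b" and ab: "a \<in> Obj C" "b \<in> Obj C" and fg: "f \<in> Hom C a b" "g \<in> Hom C b a"
    for a b f g
  proof (rule e_unique)
    show "Comp C g f \<noteq> Id C a"
    proof
      assume "Comp C g f = Id C a"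
      moreover have "finite (Hom C b b)"
        using hom[OF ab(2) ab(2)] by (intro card_ge_0_finite) simp
      ultimately have "iso_objects C a b"
        using retract_imp_iso[OF fg] hom ab by simp
      then show False
        using red that(1) ab by (auto simp: reduced_def)
    qed
  qed (use comp_hom fg ab in auto)
  have hom_ne: "\<exists>h. h \<in> Hom C a b" if "a \<in> Obj C" "b \<in> Obj C" for a b
    using nonid_ex[OF that] by blast
  \<comment> \<open>Both sides equal \<open>h g f\<close> for any \<open>g : b \<rightarrow> a\<close>.\<close>
  have slide: "Comp C (e b) f = Comp C h (e a)"
    if "a \<noteq> b" and ab: "a \<in> Obj C" "b \<in> Obj C" and fh: "f \<in> Hom C a b" "h \<in> Hom C a b"
    for a b f h
  proof -
    obtain g where g: "g \<in> Hom C b a"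
      using hom_ne ab by blast
    show ?thesis
      using comp_assoc[OF fh(1) g fh(2)] round[OF that(1) ab fh(1) g]
        round[OF that(1)[symmetric] ab(2,1) g fh(2)] by simp
  qed
  have other: "\<exists>b \<in> Obj C. b \<noteq> a" for a
    using obj by (auto simp: card_2_iff)
  \<comment> \<open>If \<open>e\<^sub>a\<close> were an involution, \<open>(e\<^sub>a g) f = 1\<close> would be an excluded round trip.\<close>
  have idem: "Comp C (e a) (e a) = e a" if a: "a \<in> Obj C" for a
  proof -
    obtain b where b: "b \<in> Obj C" "a \<noteq> b"
      using other by blast
    obtain f g where fg: "f \<in> Hom C a b" "g \<in> Hom C b a"
      using hom_ne a b by blast
    have "Comp C (e a) g \<in> Hom C b a"
      using comp_hom[OF fg(2) e(1)[OF a]] .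
    then show ?thesis
      using comp_assoc[OF fg e(1)[OF a]] round[OF b(2) a b(1) fg] round[OF b(2) a b(1) fg(1)]
      by simp
  qed
  \<comment> \<open>By \<open>slide\<close> and \<open>idem\<close> the choice of \<open>h\<close> is immaterial; over the diagonal
    \<open>h\<close> has to avoid the identity for this to be so.\<close>
  define z where "z a b = Comp C (e b) (SOME h. h \<in> Hom C a b \<and> h \<noteq> Id C a)" for a b
  have pick: "\<exists>h. h \<in> Hom C a b \<and> h \<noteq> Id C a \<and> z a b = Comp C (e b) h"
    if "a \<in> Obj C" "b \<in> Obj C" for a b
    using someI_ex[OF nonid_ex[OF that]] by (auto simp: z_def)
  have z_diag: "z a a = e a" if "a \<in> Obj C" for a
    using pick[OF that that] e_unique idem that by metis
  have z_hom: "z a b \<in> Hom C a b" if "a \<in> Obj C" "b \<in> Obj C" for a b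
    using pick[OF that] comp_hom e(1) that by metis
  have z_nonid: "nonid C (z a b)" if ab: "a \<in> Obj C" "b \<in> Obj C" for a b
    using z_hom[OF ab] z_diag[OF ab(1)] e[OF ab(1)] id_hom[OF ab(1)]
    by (cases "a = b") (auto simp: nonid_def Hom_def)
  have "Comp C g f = z (Dom C f) (Cod C g)"
    if f: "nonid C f" and g: "nonid C g" and c: "Cod C f = Dom C g" for f g
  proof -
    define p q r where "p = Dom C f" and "q = Cod C f" and "r = Cod C g"
    have fH: "f \<in> Hom C p q" "f \<noteq> Id C p" and gH: "g \<in> Hom C q r" "g \<noteq> Id C q"
      using f g c by (auto simp: nonid_def Hom_def p_def q_def r_def)
    have o: "p \<in> Obj C" "q \<in> Obj C" "r \<in> Obj C"
      using f g dom_obj cod_obj by (auto simp: nonid_def p_def q_def r_def)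
    obtain h where h: "h \<in> Hom C p r" "z p r = Comp C (e r) h"
      using pick o by blast
    have two: "p = q \<or> p = r \<or> q = r"
      using obj o by (auto simp: card_2_iff)
    have "Comp C g f = z p r"
    proof (cases "p = r")
      case True
      show ?thesis
      proof (cases "p = q")
        case True
        then have "f = e p" "g = e p"
          using fH gH o e_unique \<open>p = r\<close> by auto
        then show ?thesis
          using idem z_diag o \<open>p = r\<close> by simp
      next
        case False
        then show ?thesis
          using round[OF False o(1,2) fH(1)] gH(1) z_diag o True by simp
      qed
    next
      case pr: False
      with two consider "p = q" | "q = r"
        by blast
      then show ?thesis
      proof cases
        case 1
        then have "f = e p"
          using fH o e_unique by auto
        then show ?thesis
          using slide[OF pr o(1,3) h(1)] gH(1) h(2) 1 by simp
      next
        case 2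
        then have "g = e r"
          using gH o e_unique by auto
        then show ?thesis
          using slide[OF pr o(1,3) _ h(1)] fH(1) h 2 by simp
      qed
    qed
    then show ?thesis
      by (simp add: p_def r_def)
  qed
  then have "zero_family C z"
    using z_hom z_nonid by (simp add: zero_family_def)
  then show ?thesis
    by blast
qed

section \<open>Isomorphism of categories with zero families\<close>

text \<open>A hom set consists of its zero and one more morphism, which over the diagonal has to be
  the identity; the isomorphism matches these two morphisms in each hom set.\<close>

lemma exists_complement:
  assumes C: "category C" and z: "zero_family C z"
    and hom: "\<And>a b. a \<in> Obj C \<Longrightarrow> b \<in> Obj C \<Longrightarrow> card (Hom C a b) = 2"
  shows "\<exists>u. (\<forall>a \<in> Obj C. \<forall>b \<in> Obj C. Hom C a b = {z a b, u a b} \<and> u a b \<noteq> z a b) \<and>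
             (\<forall>a \<in> Obj C. u a a = Id C a)"
proof -
  have zH: "z a b \<in> Hom C a b" "nonid C (z a b)" if "a \<in> Obj C" "b \<in> Obj C" for a b
    using z that by (auto simp: zero_family_def)
  have ex: "\<exists>h. Hom C a b = {z a b, h} \<and> h \<noteq> z a b" if "a \<in> Obj C" "b \<in> Obj C" for a b
    using hom[OF that] zH(1)[OF that] by (auto simp: card_2_iff)
  define u where "u a b = (SOME h. Hom C a b = {z a b, h} \<and> h \<noteq> z a b)" for a b
  have u: "Hom C a b = {z a b, u a b}" "u a b \<noteq> z a b" if "a \<in> Obj C" "b \<in> Obj C" for a b
    using someI_ex[OF ex[OF that]] by (auto simp: u_def)
  have "u a a = Id C a" if a: "a \<in> Obj C" for a
  proof -
    have "Id C a \<noteq> z a a"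
      using zH[OF a a] by (auto simp: nonid_def Hom_def)
    then show ?thesis
      using u(1)[OF a a] category.id_hom[OF C a] by auto
  qed
  with u show ?thesis
    by blast
qed

lemma zero_family_imp_iso:
  fixes C :: "('o, 'm) cat" and D :: "('p, 'n) cat"
  assumes C: "category C" and z: "zero_family C z"
    and homC: "\<And>a b. a \<in> Obj C \<Longrightarrow> b \<in> Obj C \<Longrightarrow> card (Hom C a b) = 2"
    and D: "category D" and z': "zero_family D z'"
    and homD: "\<And>a b. a \<in> Obj D \<Longrightarrow> b \<in> Obj D \<Longrightarrow> card (Hom D a b) = 2"
    and \<phi>: "bij_betw \<phi> (Obj C) (Obj D)"
  shows "iso_categories C D"
proof -
  obtain u where u: "\<And>a b. a \<in> Obj C \<Longrightarrow> b \<in> Obj C \<Longrightarrow> Hom C a b = {z a b, u a b}"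
      "\<And>a b. a \<in> Obj C \<Longrightarrow> b \<in> Obj C \<Longrightarrow> u a b \<noteq> z a b"
      "\<And>a. a \<in> Obj C \<Longrightarrow> u a a = Id C a"
    using exists_complement[OF C z homC] by blast
  obtain u' where u': "\<And>a b. a \<in> Obj D \<Longrightarrow> b \<in> Obj D \<Longrightarrow> Hom D a b = {z' a b, u' a b}"
      "\<And>a b. a \<in> Obj D \<Longrightarrow> b \<in> Obj D \<Longrightarrow> u' a b \<noteq> z' a b"
      "\<And>a. a \<in> Obj D \<Longrightarrow> u' a a = Id D a"
    using exists_complement[OF D z' homD] by blast
  have \<phi>O: "\<phi> a \<in> Obj D" if "a \<in> Obj C" for a
    using \<phi> that by (auto simp: bij_betw_def)
  have \<phi>_inj: "\<phi> a = \<phi> b \<longleftrightarrow> a = b" if "a \<in> Obj C" "b \<in> Obj C" for a b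
    using \<phi> that by (auto simp: bij_betw_def inj_on_def)
  define F where "F m = (let a = Dom C m; b = Cod C m in
      if m = z a b then z' (\<phi> a) (\<phi> b) else u' (\<phi> a) (\<phi> b))" for m
  have Fz: "F (z a b) = z' (\<phi> a) (\<phi> b)" and Fu: "F (u a b) = u' (\<phi> a) (\<phi> b)"
    if ab: "a \<in> Obj C" "b \<in> Obj C" for a b
  proof -
    have "z a b \<in> Hom C a b" "u a b \<in> Hom C a b"
      using u(1)[OF ab] by auto
    then show "F (z a b) = z' (\<phi> a) (\<phi> b)" "F (u a b) = u' (\<phi> a) (\<phi> b)"
      using u(2)[OF ab] by (auto simp: F_def Hom_def)
  qed
  have F_hom: "F m \<in> Hom D (\<phi> a) (\<phi> b)"
    if "a \<in> Obj C" "b \<in> Obj C" "m \<in> Hom C a b" for a b m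
    using that u(1)[of a b] u'(1)[OF \<phi>O \<phi>O, of a b] Fz Fu by auto
  have F_id: "F (Id C a) = Id D (\<phi> a)" if "a \<in> Obj C" for a
    using Fu[OF that that] u(3) u'(3) that \<phi>O by simp
  have in_hom: "m \<in> Hom C (Dom C m) (Cod C m)" "Dom C m \<in> Obj C" "Cod C m \<in> Obj C"
    if "m \<in> Mor C" for m
    using that category.dom_obj[OF C] category.cod_obj[OF C] by (auto simp: Hom_def)
  have F_mor: "F m \<in> Mor D" "Dom D (F m) = \<phi> (Dom C m)" "Cod D (F m) = \<phi> (Cod C m)"
    if "m \<in> Mor C" for m
    using F_hom[OF in_hom(2)[OF that] in_hom(3)[OF that] in_hom(1)[OF that]]
    by (auto simp: Hom_def)
  have idD: "Id D a \<in> Hom D a a" if "a \<in> Obj D" for a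
    using category.id_hom[OF D that] .
  have F_inj: "m = n" if m: "m \<in> Mor C" and n: "n \<in> Mor C" and eq: "F m = F n" for m n
  proof -
    have "\<phi> (Dom C m) = \<phi> (Dom C n)" "\<phi> (Cod C m) = \<phi> (Cod C n)"
      using F_mor(2,3) m n eq by metis+
    then have dc: "Dom C m = Dom C n" "Cod C m = Cod C n"
      using \<phi>_inj in_hom m n by auto
    let ?a = "Dom C n" and ?b = "Cod C n"
    have o: "?a \<in> Obj C" "?b \<in> Obj C"
      using in_hom n by auto
    have "m \<in> {z ?a ?b, u ?a ?b}" "n \<in> {z ?a ?b, u ?a ?b}"
      using in_hom(1)[OF m] in_hom(1)[OF n] u(1)[OF o] dc by auto
    then show "m = n"
      using eq Fz[OF o] Fu[OF o] u'(2)[OF \<phi>O[OF o(1)] \<phi>O[OF o(2)]] by auto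
  qed
  have F_nonid: "nonid D (F m)" if m: "nonid C m" for m
  proof -
    have mM: "m \<in> Mor C" and ne: "m \<noteq> Id C (Dom C m)"
      using m by (auto simp: nonid_def)
    have o: "Dom C m \<in> Obj C"
      using in_hom mM by blast
    have "Id C (Dom C m) \<in> Mor C"
      using category.id_hom[OF C o] by (simp add: Hom_def)
    then have "F m \<noteq> F (Id C (Dom C m))"
      using F_inj mM ne by blast
    then show ?thesis
      using F_mor[OF mM] F_id[OF o] by (simp add: nonid_def)
  qed
  have F_comp: "F (Comp C g f) = Comp D (F g) (F f)"
    if f: "f \<in> Mor C" and g: "g \<in> Mor C" and c: "Cod C f = Dom C g" for f g
  proof -
    consider "nonid C f" "nonid C g" | "f = Id C (Dom C f)" | "g = Id C (Dom C g)"
      using f g by (auto simp: nonid_def)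
    then show ?thesis
    proof cases
      case 1
      then have "Comp C g f = z (Dom C f) (Cod C g)"
        using z c by (auto simp: zero_family_def)
      moreover have "Comp D (F g) (F f) = z' (Dom D (F f)) (Cod D (F g))"
        using z' F_nonid[OF 1(1)] F_nonid[OF 1(2)] F_mor f g c by (auto simp: zero_family_def)
      ultimately show ?thesis
        using Fz in_hom f g F_mor by auto
    next
      case 2
      have "Cod C f = Dom C f"
        using 2 category.id_hom[OF C in_hom(2)[OF f]] by (simp add: Hom_def)
      then have d: "Dom C f = Dom C g"
        using c by simp
      have "Comp C g f = g"
        using 2 d category.comp_id_right[OF C in_hom(1)[OF g]] by simp
      moreover have "F f = Id D (\<phi> (Dom C g))"
        using 2 d F_id[OF in_hom(2)[OF g]] by simp
      moreover have "Comp D (F g) (Id D (\<phi> (Dom C g))) = F g"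
        using category.comp_id_right[OF D F_hom[OF in_hom(2)[OF g] in_hom(3)[OF g] in_hom(1)[OF g]]] .
      ultimately show ?thesis
        by simp
    next
      case 3
      have "Comp C g f = f"
        using 3 c category.comp_id_left[OF C in_hom(1)[OF f]] by simp
      moreover have "F g = Id D (\<phi> (Cod C f))"
        using 3 c F_id[OF in_hom(3)[OF f]] by simp
      moreover have "Comp D (Id D (\<phi> (Cod C f))) (F f) = F f"
        using category.comp_id_left[OF D F_hom[OF in_hom(2)[OF f] in_hom(3)[OF f] in_hom(1)[OF f]]] .
      ultimately show ?thesis
        by simp
    qed
  qed
  have F_surj: "n \<in> F ` Mor C" if n: "n \<in> Mor D" for n
  proof -
    have "Dom D n \<in> \<phi> ` Obj C" "Cod D n \<in> \<phi> ` Obj C"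
      using category.dom_obj[OF D n] category.cod_obj[OF D n] \<phi> by (auto simp: bij_betw_def)
    then obtain a b where ab: "a \<in> Obj C" "b \<in> Obj C" "Dom D n = \<phi> a" "Cod D n = \<phi> b"
      by blast
    have "n \<in> {z' (\<phi> a) (\<phi> b), u' (\<phi> a) (\<phi> b)}"
      using u'(1)[OF \<phi>O[OF ab(1)] \<phi>O[OF ab(2)]] n ab by (auto simp: Hom_def)
    then have "n \<in> F ` {z a b, u a b}"
      using Fz Fu ab by auto
    then show ?thesis
      using u(1)[OF ab(1,2)] by (auto simp: Hom_def)
  qed
  have "bij_betw F (Mor C) (Mor D)"
    unfolding bij_betw_def inj_on_def using F_inj F_surj F_mor(1) by blast
  moreover have "is_functor C D \<phi> F"
    unfolding is_functor_def using \<phi>O F_hom F_id F_comp by blast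
  ultimately show ?thesis
    using \<phi> by (auto simp: iso_categories_def)
qed

lemma reduced_M22_iso:
  fixes C :: "('o, 'm) cat" and D :: "('p, 'n) cat"
  assumes "associated M22 C" "reduced C" "associated M22 D" "reduced D"
  shows "iso_categories C D"
proof -
  have C: "category C" "card (Obj C) = 2"
      "\<And>a b. a \<in> Obj C \<Longrightarrow> b \<in> Obj C \<Longrightarrow> card (Hom C a b) = 2"
    and D: "category D" "card (Obj D) = 2"
      "\<And>a b. a \<in> Obj D \<Longrightarrow> b \<in> Obj D \<Longrightarrow> card (Hom D a b) = 2"
    using assms by (auto simp: associated_M22_iff)
  obtain z z' where "zero_family C z" "zero_family D z'"
    using category.exists_zero_family[OF C assms(2)] category.exists_zero_family[OF D assms(4)]
    by blast
  moreover have "finite (Obj C)" "finite (Obj D)"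
    using C(2) D(2) by (auto intro: card_ge_0_finite)
  then obtain \<phi> where "bij_betw \<phi> (Obj C) (Obj D)"
    using finite_same_card_bij C(2) D(2) by metis
  ultimately show ?thesis
    using zero_family_imp_iso C D by metis
qed

section \<open>The model\<close>

text \<open>The number \<open>4 a + 2 b + t\<close> codes a morphism \<open>a \<rightarrow> b\<close>, the zero one for \<open>t = 0\<close>. Thus
  the identities of 0 and 1 are 1 and 7, and a composite of two non-identities is even.\<close>

definition model :: "(nat, nat) cat" where
  "model = \<lparr>Obj = {..<2}, Mor = {..<8}, Dom = (\<lambda>m. m div 4), Cod = (\<lambda>m. m div 2 mod 2),
     Id = (\<lambda>a. 6 * a + 1),
     Comp = (\<lambda>g f. if f \<in> {1, 7} then g else if g \<in> {1, 7} then f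
                    else 4 * (f div 4) + 2 * (g div 2 mod 2))\<rparr>"

lemma model_hom:
  assumes "a < 2" "b < 2"
  shows "Hom model a b = {4 * a + 2 * b, 4 * a + 2 * b + 1}"
proof (intro equalityI subsetI)
  fix m
  assume "m \<in> Hom model a b"
  then have "m div 2 div 2 = a" "m div 2 mod 2 = b"
    by (simp_all add: Hom_def model_def flip: div_mult2_eq)
  then have "m div 2 = 2 * a + b"
    using mult_div_mod_eq[of 2 "m div 2"] by simp
  then have "m = 4 * a + 2 * b + m mod 2"
    using mult_div_mod_eq[of 2 m] by simp
  then show "m \<in> {4 * a + 2 * b, 4 * a + 2 * b + 1}"
    using mod_less_divisor[of 2 m] by (auto simp: less_2_cases_iff)
next
  fix m
  assume "m \<in> {4 * a + 2 * b, 4 * a + 2 * b + 1}"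
  then show "m \<in> Hom model a b"
    using assms unfolding less_2_cases_iff by (auto simp: Hom_def model_def)
qed

lemma category_model: "category model"
proof
  have hom: "f \<in> Hom model a b \<longleftrightarrow>
      a < 2 \<and> b < 2 \<and> (f = 4 * a + 2 * b \<or> f = 4 * a + 2 * b + 1)" for f a b
  proof (cases "a < 2 \<and> b < 2")
    case True
    then show ?thesis
      by (simp add: model_hom)
  next
    case False
    then show ?thesis
      by (auto simp: Hom_def model_def)
  qed
  have id_iff: "f \<in> {1, 7} \<longleftrightarrow> a = b \<and> f = 4 * a + 2 * b + 1"
    if "f \<in> Hom model a b" for f a b
    using that unfolding hom by (auto simp: less_2_cases_iff)
  have comp: "Comp model g f =
      (if f \<in> {1, 7} then g else if g \<in> {1, 7} then f else 4 * a + 2 * c)"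
    if "f \<in> Hom model a b" "g \<in> Hom model b c" for f g a b c
    using that by (auto simp: Hom_def model_def)
  show comp_in: "Comp model g f \<in> Hom model a c"
    if "f \<in> Hom model a b" "g \<in> Hom model b c" for f g a b c
    using that comp[OF that] id_iff[OF that(1)] id_iff[OF that(2)]
    unfolding hom by (auto split: if_splits)
  show "Comp model h (Comp model g f) = Comp model (Comp model h g) f"
    if f: "f \<in> Hom model a b" and g: "g \<in> Hom model b c" and h: "h \<in> Hom model c d"
    for f g h a b c d
  proof -
    have "4 * i + 2 * j \<notin> {1, 7}" for i j :: nat
      by (simp, presburger)
    moreover have "f \<in> {1, 7} \<Longrightarrow> a = b" "h \<in> {1, 7} \<Longrightarrow> c = d"
      using id_iff[OF f] id_iff[OF h] by blast+
    ultimately show ?thesis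
      unfolding comp[OF f g] comp[OF g h] comp[OF f comp_in[OF g h], unfolded comp[OF g h]]
        comp[OF comp_in[OF f g] h, unfolded comp[OF f g]]
      by auto
  qed
  show "Comp model f (Id model a) = f" if "f \<in> Hom model a b" for f a b
    using that[unfolded hom less_2_cases_iff] by (auto simp: model_def)
  show "Comp model (Id model b) f = f" if "f \<in> Hom model a b" for f a b
    using that[unfolded hom less_2_cases_iff] by (auto simp: model_def)
  show "Dom model f \<in> Obj model" "Cod model f \<in> Obj model" if "f \<in> Mor model" for f
    using that by (auto simp: model_def)
  show "Id model a \<in> Hom model a a" if "a \<in> Obj model" for a
    using that unfolding hom by (auto simp: model_def)
qed

lemma associated_model: "associated M22 model"
proof -
  have "Obj model = {..<2}"
    by (simp add: model_def)
  then show ?thesis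
    by (simp add: associated_M22_iff category_model model_hom)
qed

lemma reduced_model: "reduced model"
  unfolding reduced_def
proof (intro ballI impI)
  fix a b
  assume "a \<in> Obj model" "b \<in> Obj model" and ne: "a \<noteq> b"
  then have ab: "a < 2" "b < 2"
    by (auto simp: model_def)
  have "a = 0 \<and> b = 1 \<or> a = 1 \<and> b = 0"
    using ab ne by presburger
  then have "Comp model g f \<noteq> Id model a" if "f \<in> Hom model a b" "g \<in> Hom model b a" for f g
    using that by (elim disjE conjE) (auto simp: model_hom, auto simp: model_def)
  then show "\<not> iso_objects model a b"
    by (auto simp: iso_objects_def)
qed

theorem mainTheorem2:
  shows "(\<exists>R :: (nat, nat) cat. associated M22 R \<and> reduced R \<and>
            (\<forall>C :: ('o, 'm) cat. associated M22 C \<and> reduced C \<longrightarrow> iso_categories C R)) \<and>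
         Card_r M22 = 1"
proof
  have "associated M22 C \<and> reduced C \<longrightarrow> iso_categories C model" for C :: "('o, 'm) cat"
    using reduced_M22_iso[OF _ _ associated_model reduced_model] by blast
  then show "\<exists>R :: (nat, nat) cat. associated M22 R \<and> reduced R \<and>
            (\<forall>C :: ('o, 'm) cat. associated M22 C \<and> reduced C \<longrightarrow> iso_categories C R)"
    using associated_model reduced_model by blast
  have in_cats: "C \<in> reduced_cats M22 \<longleftrightarrow> associated M22 C \<and> reduced C"
    for C :: "(nat, nat) cat"
    by (simp add: reduced_cats_def)
  have "(C, D) \<in> iso_rel M22 \<longleftrightarrow> C \<in> reduced_cats M22 \<and> D \<in> reduced_cats M22" for C D
    using reduced_M22_iso[of C D] in_cats by (auto simp: iso_rel_def)
  then have "iso_rel M22 `` {C} = reduced_cats M22" if "C \<in> reduced_cats M22" for C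
    using that by blast
  moreover have "model \<in> reduced_cats M22"
    by (simp add: in_cats associated_model reduced_model)
  ultimately have "reduced_cats M22 // iso_rel M22 = {reduced_cats M22}"
    unfolding quotient_def by blast
  then show "Card_r M22 = 1"
    by (simp add: Card_r_def)
qed

end
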